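(* Let $n\geq 1$ be an odd integer. There exists a deeply critical oriented clique of order $n$ if and only if $n\geq 5$ and $n\neq 7$.
   Context: An oriented graph $\overrightarrow{G}$ is a directed graph with no loops and no directed cycles of length two (irreflexive and anti-symmetric). An oriented $k$-colouring of $\overrightarrow{G}$ is a function $\phi:V(\overrightarrow{G})\to\{1,\dots,k\}$ such that (i) $\phi(x)\neq\phi(y)$ for every arc $xy$, and (ii) for all arcs $xy,uv$, if $\phi(x)=\phi(v)$ then $\phi(y)\neq\phi(u)$. The oriented chromatic number $\chi_o(\overrightarrow{G})$ is the least $k$ for which an oriented $k$-colouring exists. An absolute oriented clique (oriented clique) is an oriented graph with $\chi_o(\overrightarrow{G})=|V(\overrightarrow{G})|$. An oriented graph is deeply critical if $\chi_o(\overrightarrow{G}-xy)=\chi_o(\overrightarrow{G})-2$ for every arc $xy$. A deeply critical oriented clique is an oriented graph that is both deeply critical and an absolute oriented clique; its order is its number of vertices.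
   Formalization: The clique is required to have at least one arc: the single vertex without arcs is vacuously a deeply critical oriented clique of order 1, so the claim read literally fails at n = 1; for n ≥ 2 the requirement is automatic. *)

theory Defs
  imports "Graph_Theory.Pair_Digraph"
begin

definition oriented_graph :: "'a pair_pre_digraph \<Rightarrow> bool" where
  "oriented_graph G \<longleftrightarrow> pair_digraph G \<and> antisym (parcs G)"

definition oriented_colouring :: "'a pair_pre_digraph \<Rightarrow> nat \<Rightarrow> ('a \<Rightarrow> nat) \<Rightarrow> bool" where
  "oriented_colouring G k \<phi> \<longleftrightarrow>
     \<phi> ` pverts G \<subseteq> {1..k} \<and>
     (\<forall>x y. (x, y) \<in> parcs G \<longrightarrow> \<phi> x \<noteq> \<phi> y) \<and>
     (\<forall>x y u v. (x, y) \<in> parcs G \<longrightarrow> (u, v) \<in> parcs G \<longrightarrow> \<phi> x = \<phi> v \<longrightarrow> \<phi> y \<noteq> \<phi> u)"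

definition oriented_chromatic_number :: "'a pair_pre_digraph \<Rightarrow> nat" where
  "oriented_chromatic_number G = (LEAST k. \<exists>\<phi>. oriented_colouring G k \<phi>)"

definition del_parc :: "'a pair_pre_digraph \<Rightarrow> 'a \<times> 'a \<Rightarrow> 'a pair_pre_digraph" where
  "del_parc G e = G\<lparr>parcs := parcs G - {e}\<rparr>"

lemma with_proj_del_parc: "with_proj (del_parc G e) = pre_digraph.del_arc (with_proj G) e"
  by (simp add: del_parc_def pre_digraph.del_arc_def with_proj_def)

definition absolute_oriented_clique :: "'a pair_pre_digraph \<Rightarrow> bool" where
  "absolute_oriented_clique G \<longleftrightarrow>
     oriented_graph G \<and> oriented_chromatic_number G = card (pverts G)"

(* The subtraction is taken in the integers, where it does not truncate.
   The condition on arcs is vacuous for a graph without arcs, in particular for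
   the graph with a single vertex, which is also an absolute oriented clique. *)
definition deeply_critical :: "'a pair_pre_digraph \<Rightarrow> bool" where
  "deeply_critical G \<longleftrightarrow> oriented_graph G \<and>
     (\<forall>e \<in> parcs G. int (oriented_chromatic_number (del_parc G e)) =
        int (oriented_chromatic_number G) - 2)"

definition deeply_critical_oriented_clique :: "'a pair_pre_digraph \<Rightarrow> bool" where
  "deeply_critical_oriented_clique G \<longleftrightarrow> deeply_critical G \<and> absolute_oriented_clique G"

(* The set in the definition of the oriented chromatic number is inhabited. *)
lemma oriented_colouring_exists:
  assumes "oriented_graph G"
  shows "\<exists>\<phi>. oriented_colouring G (card (pverts G)) \<phi>"
proof -
  from assms interpret pair_digraph G by (simp add: oriented_graph_def)
  obtain \<phi> where \<phi>: "bij_betw \<phi> (pverts G) {1..card (pverts G)}"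
    using pair_finite_verts by (metis ex_bij_betw_finite_nat card_atLeastAtMost
        finite_atLeastAtMost finite_same_card_bij diff_Suc_1)
  have inj: "\<phi> x = \<phi> y \<Longrightarrow> x = y" if "x \<in> pverts G" "y \<in> pverts G" for x y
    using \<phi> that by (auto simp: bij_betw_def inj_on_def)
  have "oriented_colouring G (card (pverts G)) \<phi>"
    unfolding oriented_colouring_def
  proof (intro conjI allI impI)
    show "\<phi> ` pverts G \<subseteq> {1..card (pverts G)}"
      using \<phi> by (simp add: bij_betw_def)
  next
    fix x y assume "(x, y) \<in> parcs G"
    then show "\<phi> x \<noteq> \<phi> y"
      using inj pair_no_loops[of "(x, y)"] by (auto dest: in_arcsD1 in_arcsD2)
  next
    fix x y u v assume *: "(x, y) \<in> parcs G" "(u, v) \<in> parcs G" "\<phi> x = \<phi> v"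
    then have "x = v" using inj by (auto dest: in_arcsD1 in_arcsD2)
    show "\<phi> y \<noteq> \<phi> u"
    proof
      assume "\<phi> y = \<phi> u"
      then have "y = u" using inj * by (auto dest: in_arcsD1 in_arcsD2)
      with * \<open>x = v\<close> assms have "x = y"
        by (auto simp: oriented_graph_def dest: antisymD)
      with * pair_no_loops[of "(x, y)"] show False by auto
    qed
  qed
  then show ?thesis by blast
qed

end

theory Submission
  imports Defs "HOL-Library.Countable"
begin

text \<open>
  In an oriented clique minus an arc \<open>xy\<close>, the only pairs that can share a colour are those whose sole
  connection ran through \<open>xy\<close>; each contains \<open>x\<close> or \<open>y\<close>. Saving two colours therefore means merging
  \<open>x\<close> with some \<open>w\<close> and \<open>y\<close> with some \<open>w'\<close>, where \<open>w' \<rightarrow> x \<rightarrow> y \<rightarrow> w\<close>, the 2-dipaths \<open>xyw\<close> and \<open>w'xy\<close>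
  are the sole connections of their ends, and \<open>w\<close> does not dominate \<open>w'\<close>. Being a deeply critical
  oriented clique becomes a local condition.

  Each arc uses up an unordered non-adjacent pair \<open>{x, w}\<close>, so \<open>2|E|\<close> is at most the number of pairs.
  On 7 vertices this gives \<open>|E| \<le> 10\<close> and hence a vertex \<open>v\<close> with one in-neighbour \<open>a\<close> and one
  out-neighbour \<open>b\<close>. The other four vertices split into in-neighbours of \<open>a\<close> and out-neighbours
  of \<open>b\<close>; criticality of their arcs to \<open>a\<close> and from \<open>b\<close> forces two matched pairs, and these four
  vertices cannot be completed.

  For orders \<open>4k + 1\<close> and \<open>4k + 3\<close> with \<open>k \<ge> 3\<close> take four copies of the vertex set of a tournament
  on \<open>k\<close> vertices without sources and sinks, together with one or three further vertices.
  Orders 5, 9 and 11 are covered by explicit graphs.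
\<close>

section \<open>A local description\<close>

text \<open>In an oriented graph these are, for distinct vertices, exactly the pairs that every
  oriented colouring has to separate.\<close>

definition joined :: "'a rel \<Rightarrow> 'a \<Rightarrow> 'a \<Rightarrow> bool" where
  "joined E x y \<longleftrightarrow> (x, y) \<in> E \<or> (y, x) \<in> E \<or>
     (\<exists>z. (x, z) \<in> E \<and> (z, y) \<in> E) \<or> (\<exists>z. (y, z) \<in> E \<and> (z, x) \<in> E)"

text \<open>Once \<open>(x, y)\<close> is deleted, \<open>w\<close> is to share the colour of
  \<open>x\<close> and \<open>w'\<close> that of \<open>y\<close>. The condition
  \<open>(w, w') \<notin> E\<close> keeps all arcs between the two merged classes in one
  direction.\<close>

definition arc_critical :: "'a rel \<Rightarrow> 'a \<Rightarrow> 'a \<Rightarrow> bool" where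
  "arc_critical E x y \<longleftrightarrow> (\<exists>w w'. (y, w) \<in> E \<and> (w', x) \<in> E \<and> (w, w') \<notin> E \<and>
     \<not> joined (E - {(x, y)}) x w \<and> \<not> joined (E - {(x, y)}) w' y)"

text \<open>Stated for a set and a relation over any type, so that each construction can choose its
  own vertices before it is moved to the natural numbers.\<close>

definition critical_clique :: "'a set \<Rightarrow> 'a rel \<Rightarrow> bool" where
  "critical_clique V E \<longleftrightarrow> finite V \<and> E \<subseteq> V \<times> V \<and> irrefl E \<and> antisym E \<and>
     (\<forall>x\<in>V. \<forall>y\<in>V. x \<noteq> y \<longrightarrow> joined E x y) \<and> (\<forall>(x, y)\<in>E. arc_critical E x y)"

lemma joined_sym: "joined E x y \<longleftrightarrow> joined E y x"
  by (auto simp: joined_def)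

section \<open>Oriented colourings and the merging of vertices\<close>

lemma oriented_graph_iff:
  "oriented_graph G \<longleftrightarrow> finite (pverts G) \<and> parcs G \<subseteq> pverts G \<times> pverts G \<and>
     irrefl (parcs G) \<and> antisym (parcs G)"
proof
  assume G: "oriented_graph G"
  then interpret pair_digraph G by (simp add: oriented_graph_def)
  show "finite (pverts G) \<and> parcs G \<subseteq> pverts G \<times> pverts G \<and> irrefl (parcs G) \<and> antisym (parcs G)"
    using G pair_finite_verts pair_no_loops
    by (fastforce simp: oriented_graph_def irrefl_def dest: in_arcsD1 in_arcsD2)
next
  assume G: "finite (pverts G) \<and> parcs G \<subseteq> pverts G \<times> pverts G \<and> irrefl (parcs G) \<and> antisym (parcs G)"
  then have "finite (parcs G)"
    by (meson finite_SigmaI finite_subset)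
  with G show "oriented_graph G"
    unfolding oriented_graph_def by (intro conjI, unfold_locales) (auto simp: irrefl_def)
qed

lemma oriented_graph_del_parc: "oriented_graph G \<Longrightarrow> oriented_graph (del_parc G e)"
  by (auto simp: oriented_graph_iff del_parc_def irrefl_def antisym_def)

lemma oriented_colouring_chromatic_number:
  assumes "oriented_graph G"
  obtains \<phi> where "oriented_colouring G (oriented_chromatic_number G) \<phi>"
  using LeastI_ex[of "\<lambda>k. \<exists>\<phi>. oriented_colouring G k \<phi>"] oriented_colouring_exists[OF assms]
  unfolding oriented_chromatic_number_def by blast

lemma oriented_chromatic_number_le:
  "oriented_colouring G k \<phi> \<Longrightarrow> oriented_chromatic_number G \<le> k"
  unfolding oriented_chromatic_number_def by (rule Least_le) blast

text \<open>Only the number of colours matters, since a bijection renames them to an initial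
  segment. This allows vertices to serve as colours, with \<open>c\<close> sending each vertex to
  the representative of its class.\<close>

lemma oriented_chromatic_number_le_card_image:
  assumes G: "oriented_graph G"
    and 1: "\<And>x y. (x, y) \<in> parcs G \<Longrightarrow> c x \<noteq> c y"
    and 2: "\<And>x y u v. (x, y) \<in> parcs G \<Longrightarrow> (u, v) \<in> parcs G \<Longrightarrow> c x = c v \<Longrightarrow> c y \<noteq> c u"
  shows "oriented_chromatic_number G \<le> card (c ` pverts G)"
proof -
  have fin: "finite (c ` pverts G)" and sub: "parcs G \<subseteq> pverts G \<times> pverts G"
    using G by (auto simp: oriented_graph_iff)
  then obtain h where h: "bij_betw h (c ` pverts G) {1..card (c ` pverts G)}"
    using finite_same_card_bij[of "c ` pverts G" "{1..card (c ` pverts G)}"] by auto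
  have inj: "h (c x) = h (c y) \<longleftrightarrow> c x = c y" if "x \<in> pverts G" "y \<in> pverts G" for x y
    using h that by (auto simp: bij_betw_def inj_on_def)
  have "oriented_colouring G (card (c ` pverts G)) (h \<circ> c)"
    unfolding oriented_colouring_def
  proof (intro conjI allI impI)
    show "(h \<circ> c) ` pverts G \<subseteq> {1..card (c ` pverts G)}"
      using h by (auto simp: bij_betw_def)
  next
    fix x y assume "(x, y) \<in> parcs G"
    then show "(h \<circ> c) x \<noteq> (h \<circ> c) y" using 1 sub inj by auto
  next
    fix x y u v assume "(x, y) \<in> parcs G" "(u, v) \<in> parcs G" "(h \<circ> c) x = (h \<circ> c) v"
    then show "(h \<circ> c) y \<noteq> (h \<circ> c) u"
      using 2[of x y u v] sub inj[of x v] inj[of y u] by auto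
  qed
  then show ?thesis by (rule oriented_chromatic_number_le)
qed

text \<open>For the two arcs of a 2-dipath with equally coloured ends, the second colouring
  condition would make the colour of the middle vertex differ from itself.\<close>

lemma oriented_colouring_joined:
  assumes "oriented_colouring G k \<phi>" "joined (parcs G) x y"
  shows "\<phi> x \<noteq> \<phi> y"
  using assms unfolding oriented_colouring_def joined_def by metis

text \<open>If all pairs are joined, every colouring is injective. Conversely, two vertices that are
  not joined can be coloured alike while all others keep their own colours, which saves one
  colour.\<close>

lemma absolute_oriented_clique_iff:
  "absolute_oriented_clique G \<longleftrightarrow> oriented_graph G \<and>
     (\<forall>x\<in>pverts G. \<forall>y\<in>pverts G. x \<noteq> y \<longrightarrow> joined (parcs G) x y)"
  (is "_ \<longleftrightarrow> _ \<and> ?J")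
proof (cases "oriented_graph G")
  case G: True
  then have fin: "finite (pverts G)" and sub: "parcs G \<subseteq> pverts G \<times> pverts G"
    and irr: "irrefl (parcs G)" and anti: "antisym (parcs G)"
    by (auto simp: oriented_graph_iff)
  have "oriented_chromatic_number G = card (pverts G) \<longleftrightarrow> ?J"
  proof
    assume J: ?J
    obtain \<phi> where \<phi>: "oriented_colouring G (oriented_chromatic_number G) \<phi>"
      using oriented_colouring_chromatic_number[OF G] .
    then have "inj_on \<phi> (pverts G)" and im: "\<phi> ` pverts G \<subseteq> {1..oriented_chromatic_number G}"
      using J oriented_colouring_joined[OF \<phi>]
      by (auto simp: inj_on_def oriented_colouring_def)
    then have "card (pverts G) \<le> oriented_chromatic_number G"
      using card_inj_on_le[of \<phi> "pverts G" "{1..oriented_chromatic_number G}"] by simp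
    moreover have "oriented_chromatic_number G \<le> card (pverts G)"
      using oriented_colouring_exists[OF G] oriented_chromatic_number_le by blast
    ultimately show "oriented_chromatic_number G = card (pverts G)" by simp
  next
    assume n: "oriented_chromatic_number G = card (pverts G)"
    show ?J
    proof (intro ballI impI, rule ccontr)
      fix x y assume xy: "x \<in> pverts G" "y \<in> pverts G" "x \<noteq> y" "\<not> joined (parcs G) x y"
      define c where "c = (\<lambda>z. if z = y then x else z)"
      have "oriented_chromatic_number G \<le> card (c ` pverts G)"
      proof (rule oriented_chromatic_number_le_card_image[OF G])
        show "c u \<noteq> c v" if "(u, v) \<in> parcs G" for u v
          using that xy irr by (auto simp: c_def joined_def irrefl_def split: if_splits)
        show "c v \<noteq> c s" if "(u, v) \<in> parcs G" "(s, t) \<in> parcs G" "c u = c t" for u v s t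
          using that xy irr anti
          by (auto simp: c_def joined_def irrefl_def dest: antisymD split: if_splits)
      qed
      also have "c ` pverts G = pverts G - {y}"
        using xy by (auto simp: c_def)
      also have "card \<dots> < card (pverts G)"
        using xy fin by (intro card_Diff1_less)
      finally show False using n by simp
    qed
  qed
  with G show ?thesis by (simp add: absolute_oriented_clique_def)
qed (simp add: absolute_oriented_clique_def)

text \<open>Giving the two ends of the deleted arc fresh colours repairs the colouring.\<close>

lemma oriented_chromatic_number_del_parc:
  assumes G: "oriented_graph G"
  shows "oriented_chromatic_number G \<le> oriented_chromatic_number (del_parc G e) + 2"
proof -
  obtain x y where e: "e = (x, y)" by force
  let ?k = "oriented_chromatic_number (del_parc G e)"
  have irr: "irrefl (parcs G)" and anti: "antisym (parcs G)"
    using G by (auto simp: oriented_graph_iff)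
  obtain \<phi> where \<phi>: "oriented_colouring (del_parc G e) ?k \<phi>"
    using oriented_colouring_chromatic_number[OF oriented_graph_del_parc[OF G]] .
  define \<psi> where "\<psi> = \<phi>(x := ?k + 1, y := ?k + 2)"
  have im: "\<phi> z \<le> ?k" "1 \<le> \<phi> z" if "z \<in> pverts G" for z
    using \<phi> that by (auto simp: oriented_colouring_def del_parc_def)
  have ends: "u \<in> pverts G" "v \<in> pverts G" if "(u, v) \<in> parcs G" for u v
    using G that by (auto simp: oriented_graph_iff)
  have p1: "\<phi> u \<noteq> \<phi> v" if "(u, v) \<in> parcs G" "(u, v) \<noteq> e" for u v
    using \<phi> that by (auto simp: oriented_colouring_def del_parc_def)
  have p2: "\<phi> v \<noteq> \<phi> s" if "(u, v) \<in> parcs G" "(u, v) \<noteq> e" "(s, t) \<in> parcs G" "(s, t) \<noteq> e"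
    "\<phi> u = \<phi> t" for u v s t
    using \<phi> that by (auto simp: oriented_colouring_def del_parc_def)
  have eq: "\<psi> u = \<psi> v \<longleftrightarrow> u = v \<or> u \<notin> {x, y} \<and> v \<notin> {x, y} \<and> \<phi> u = \<phi> v"
    if "u \<in> pverts G" "v \<in> pverts G" for u v
    using im[OF that(1)] im[OF that(2)] by (auto simp: \<psi>_def)
  have "oriented_colouring G (?k + 2) \<psi>"
    unfolding oriented_colouring_def
  proof (intro conjI allI impI)
    show "\<psi> ` pverts G \<subseteq> {1..?k + 2}"
    proof (rule image_subsetI)
      fix z assume "z \<in> pverts G"
      then show "\<psi> z \<in> {1..?k + 2}" using im[of z] by (auto simp: \<psi>_def)
    qed
  next
    fix u v assume uv: "(u, v) \<in> parcs G"
    then show "\<psi> u \<noteq> \<psi> v"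
      using eq[OF ends[OF uv]] p1[OF uv] irr by (auto simp: e irrefl_def)
  next
    fix u v s t assume uv: "(u, v) \<in> parcs G" and st: "(s, t) \<in> parcs G" and "\<psi> u = \<psi> t"
    then have ut: "u = t \<or> u \<notin> {x, y} \<and> t \<notin> {x, y} \<and> \<phi> u = \<phi> t"
      using eq[OF ends(1)[OF uv] ends(2)[OF st]] by simp
    show "\<psi> v \<noteq> \<psi> s"
    proof
      assume "\<psi> v = \<psi> s"
      then have vs: "v = s \<or> v \<notin> {x, y} \<and> s \<notin> {x, y} \<and> \<phi> v = \<phi> s"
        using eq[OF ends(2)[OF uv] ends(1)[OF st]] by simp
      show False
      proof (cases "u = t \<and> v = s")
        case True
        with uv st irr anti show False by (auto simp: irrefl_def dest: antisymD)
      next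
        case False
        \<comment> \<open>The ends of \<open>e\<close> are alone in their colour classes, so if
          either arc were \<open>e\<close>, then \<open>u = t\<close> and \<open>v = s\<close> would
          follow, the case already settled.\<close>
        then have "(u, v) \<noteq> e" "(s, t) \<noteq> e" using ut vs by (auto simp: e)
        with p2[OF uv _ st] ut vs show False by auto
      qed
    qed
  qed
  then show ?thesis by (rule oriented_chromatic_number_le)
qed


section \<open>Critical arcs and the saving of two colours\<close>

text \<open>Merging \<open>w\<close> into \<open>x\<close> and \<open>w'\<close> into
  \<open>y\<close> colours the graph without \<open>(x, y)\<close> by the vertices other than
  \<open>w\<close> and \<open>w'\<close>.\<close>

lemma arc_critical_chromatic_number:
  assumes G: "oriented_graph G" and xy: "(x, y) \<in> parcs G"
    and crit: "arc_critical (parcs G) x y"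
  shows "oriented_chromatic_number (del_parc G (x, y)) + 2 \<le> card (pverts G)"
proof -
  define E where "E = parcs G - {(x, y)}"
  obtain w w' where w: "(y, w) \<in> parcs G" "(w', x) \<in> parcs G" "(w, w') \<notin> parcs G"
    "\<not> joined E x w" "\<not> joined E w' y"
    using crit unfolding arc_critical_def E_def by blast
  have fin: "finite (pverts G)" and sub: "parcs G \<subseteq> pverts G \<times> pverts G"
    and irr: "irrefl (parcs G)" and anti: "antisym (parcs G)"
    using G by (auto simp: oriented_graph_iff)
  have asym: "(v, u) \<notin> parcs G" if "(u, v) \<in> parcs G" for u v
    using that irr anti by (auto simp: irrefl_def dest: antisymD)
  have ne: "x \<noteq> y" "w \<noteq> x" "w \<noteq> y" "w' \<noteq> x" "w' \<noteq> y" "w \<noteq> w'"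
    using w xy asym unfolding E_def joined_def by blast+
  have V: "x \<in> pverts G" "y \<in> pverts G" "w \<in> pverts G" "w' \<in> pverts G"
    using w xy sub by auto
  define c where "c = (\<lambda>z. if z = w then x else if z = w' then y else z)"
  have c_eq: "c u = c v \<longleftrightarrow> u = v \<or> u \<in> {x, w} \<and> v \<in> {x, w} \<or> u \<in> {y, w'} \<and> v \<in> {y, w'}" for u v
    using ne by (auto simp: c_def)
  \<comment> \<open>All remaining arcs between the merged classes run from \<open>{y, w'}\<close> to
    \<open>{x, w}\<close>.\<close>
  have no_arc: "(u, v) \<notin> E" if "u \<in> {x, w}" "v \<in> {y, w'}" for u v
    using that w asym unfolding E_def by blast
  have c_joined: "\<not> joined E u v" if "c u = c v" "u \<noteq> v" for u v
  proof -
    have "\<not> joined E w x" "\<not> joined E y w'" using w by (metis joined_sym)+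
    with that w show ?thesis by (auto simp: c_eq)
  qed
  have "oriented_chromatic_number (del_parc G (x, y)) \<le> card (c ` pverts (del_parc G (x, y)))"
  proof (rule oriented_chromatic_number_le_card_image[OF oriented_graph_del_parc[OF G]])
    show "c u \<noteq> c v" if "(u, v) \<in> parcs (del_parc G (x, y))" for u v
      using that c_joined[of u v] irr
      by (auto simp: del_parc_def E_def joined_def irrefl_def)
    show "c v \<noteq> c s" if "(u, v) \<in> parcs (del_parc G (x, y))" "(s, t) \<in> parcs (del_parc G (x, y))"
      "c u = c t" for u v s t
    proof
      assume vs: "c v = c s"
      have E: "(u, v) \<in> E" "(s, t) \<in> E" using that by (auto simp: del_parc_def E_def)
      show False
      proof (cases "u = t \<or> v = s")
        case True
        then show False
          using c_joined[of v s] c_joined[of u t] E that(3) vs asym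
          unfolding E_def joined_def by (metis DiffD1)
      next
        case False
        \<comment> \<open>Both coincidences of colours now come from merged pairs. The two pairs are
          different, so the arcs \<open>(u, v)\<close> and \<open>(s, t)\<close> run in opposite
          directions between the classes.\<close>
        then have "u \<in> {x, w} \<and> t \<in> {x, w} \<or> u \<in> {y, w'} \<and> t \<in> {y, w'}"
          "v \<in> {x, w} \<and> s \<in> {x, w} \<or> v \<in> {y, w'} \<and> s \<in> {y, w'}"
          using that vs by (simp_all add: c_eq)
        moreover have "c u \<noteq> c v"
          using E c_joined[of u v] irr by (auto simp: E_def joined_def irrefl_def)
        ultimately show False
          using no_arc E by (metis c_eq)
      qed
    qed
  qed
  also have "c ` pverts (del_parc G (x, y)) = pverts G - {w, w'}"
    using V ne by (auto simp: c_def del_parc_def)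
  also have "card \<dots> = card (pverts G) - 2"
    using V ne fin by (simp add: card_Diff_subset)
  \<comment> \<open>There are at least the two vertices \<open>x\<close> and \<open>y\<close>, so
    the subtraction in the natural numbers does not truncate.\<close>
  finally show ?thesis
    using card_mono[OF fin, of "{x, y}"] V ne by simp
qed

text \<open>The vertices other than \<open>x\<close> and \<open>y\<close> keep distinct colours and
  number exactly as many as the colours. They use every colour, so the colours of \<open>x\<close>
  and \<open>y\<close> recur among them, at \<open>w\<close> and \<open>w'\<close>.\<close>

lemma chromatic_number_arc_critical:
  assumes G: "absolute_oriented_clique G" and xy: "(x, y) \<in> parcs G"
    and chi: "int (oriented_chromatic_number (del_parc G (x, y))) = int (card (pverts G)) - 2"
  shows "arc_critical (parcs G) x y"
proof -
  define E where "E = parcs G - {(x, y)}"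
  let ?k = "oriented_chromatic_number (del_parc G (x, y))"
  have og: "oriented_graph G"
    and J: "\<And>u v. u \<in> pverts G \<Longrightarrow> v \<in> pverts G \<Longrightarrow> u \<noteq> v \<Longrightarrow> joined (parcs G) u v"
    using G by (auto simp: absolute_oriented_clique_iff)
  then have fin: "finite (pverts G)" and sub: "parcs G \<subseteq> pverts G \<times> pverts G"
    and irr: "irrefl (parcs G)" and anti: "antisym (parcs G)"
    by (auto simp: oriented_graph_iff)
  have asym: "(v, u) \<notin> parcs G" if "(u, v) \<in> parcs G" for u v
    using that irr anti by (auto simp: irrefl_def dest: antisymD)
  have V: "x \<in> pverts G" "y \<in> pverts G" "x \<noteq> y" using xy sub irr by (auto simp: irrefl_def)
  obtain \<phi> where \<phi>: "oriented_colouring (del_parc G (x, y)) ?k \<phi>"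
    using oriented_colouring_chromatic_number[OF oriented_graph_del_parc[OF og]] .
  have im: "\<phi> ` pverts G \<subseteq> {1..?k}"
    using \<phi> by (auto simp: oriented_colouring_def del_parc_def)
  have nj: "\<not> joined E u v" if "\<phi> u = \<phi> v" for u v
    using oriented_colouring_joined[OF \<phi>, of u v] that by (auto simp: del_parc_def E_def)
  \<comment> \<open>A 2-dipath through the arc \<open>(x, y)\<close> has \<open>x\<close> or
    \<open>y\<close> as an end, so pairs avoiding both stay joined.\<close>
  have "joined E u v" if "u \<in> pverts G - {x, y}" "v \<in> pverts G - {x, y}" "u \<noteq> v" for u v
    using J[of u v] that by (auto simp: joined_def E_def)
  then have "inj_on \<phi> (pverts G - {x, y})"
    using nj by (auto simp: inj_on_def)
  then have "card (\<phi> ` (pverts G - {x, y})) = card (pverts G) - 2"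
    using V fin by (simp add: card_image card_Diff_subset)
  also have "\<dots> = card {1..?k}" using chi by simp
  finally have onto: "\<phi> ` (pverts G - {x, y}) = {1..?k}"
    using im by (intro card_subset_eq) auto
  then have "\<phi> x \<in> \<phi> ` (pverts G - {x, y})" "\<phi> y \<in> \<phi> ` (pverts G - {x, y})"
    using im V by auto
  then obtain w w' where w: "w \<in> pverts G - {x, y}" "\<phi> x = \<phi> w"
    and w': "w' \<in> pverts G - {x, y}" "\<phi> y = \<phi> w'"
    by blast
  note n = nj[OF w(2)] nj[OF w'(2)[symmetric]]
  have "\<phi> x \<noteq> \<phi> w'"
  proof
    assume "\<phi> x = \<phi> w'"
    then have "\<phi> x = \<phi> w" "\<phi> y = \<phi> w" using w w' by simp_all
    then have "\<not> joined E x w" "\<not> joined E y w" by (simp_all add: nj)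
    then show False
      using J[of x w] w V unfolding joined_def E_def by blast
  qed
  \<comment> \<open>\<open>x\<close> and \<open>w\<close> are joined in \<open>G\<close> but not
    after the deletion, which leaves only the 2-dipath through \<open>y\<close>. The argument for
    \<open>w'\<close> is dual.\<close>
  have yw: "(y, w) \<in> parcs G"
    using J[of x w] n(1) w V by (auto simp: joined_def E_def)
  have wx: "(w', x) \<in> parcs G"
    using J[of w' y] n(2) w' V by (auto simp: joined_def E_def)
  \<comment> \<open>Such an arc would complete a 2-dipath from \<open>y\<close> through
    \<open>w\<close> to \<open>w'\<close>, whose ends have the same colour.\<close>
  have "(w, w') \<notin> parcs G"
  proof
    assume "(w, w') \<in> parcs G"
    then have "(w, w') \<in> parcs (del_parc G (x, y))" "(y, w) \<in> parcs (del_parc G (x, y))"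
      using w yw V by (auto simp: del_parc_def)
    then show False
      using \<phi> w w' unfolding oriented_colouring_def by metis
  qed
  with n yw wx show ?thesis unfolding arc_critical_def E_def by blast
qed

text \<open>No deletion of an arc saves more than two colours, so being deeply critical asks that
  every deletion saves at least two.\<close>

lemma deeply_critical_oriented_clique_iff:
  "deeply_critical_oriented_clique G \<longleftrightarrow> critical_clique (pverts G) (parcs G)"
proof
  assume G: "deeply_critical_oriented_clique G"
  then have "absolute_oriented_clique G"
    by (simp add: deeply_critical_oriented_clique_def)
  moreover have "arc_critical (parcs G) x y" if "(x, y) \<in> parcs G" for x y
    using G that
    by (intro chromatic_number_arc_critical)
      (auto simp: deeply_critical_oriented_clique_def deeply_critical_def absolute_oriented_clique_def)
  ultimately show "critical_clique (pverts G) (parcs G)"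
    by (auto simp: critical_clique_def absolute_oriented_clique_iff oriented_graph_iff)
next
  assume G: "critical_clique (pverts G) (parcs G)"
  then have cl: "absolute_oriented_clique G" and og: "oriented_graph G"
    by (auto simp: critical_clique_def absolute_oriented_clique_iff oriented_graph_iff)
  then have n: "oriented_chromatic_number G = card (pverts G)"
    by (simp add: absolute_oriented_clique_def)
  have "int (oriented_chromatic_number (del_parc G e)) = int (oriented_chromatic_number G) - 2"
    if "e \<in> parcs G" for e
  proof -
    obtain x y where e: "e = (x, y)" by force
    with G that have "arc_critical (parcs G) x y" by (auto simp: critical_clique_def)
    then show ?thesis
      using arc_critical_chromatic_number[OF og, of x y] oriented_chromatic_number_del_parc[OF og, of e]
        that n by (simp add: e)
  qed
  with cl og show "deeply_critical_oriented_clique G"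
    by (simp add: deeply_critical_oriented_clique_def deeply_critical_def)
qed

text \<open>The conditions speak of arcs only, and an injective \<open>f\<close> both preserves and
  reflects these.\<close>

lemma critical_clique_image:
  assumes f: "inj f" and G: "critical_clique V E"
  shows "critical_clique (f ` V) (map_prod f f ` E)"
proof -
  have mem: "(f u, f v) \<in> map_prod f f ` F \<longleftrightarrow> (u, v) \<in> F" for F u v
    using f by (auto simp: inj_def)
  have pre: "(f u, z) \<in> map_prod f f ` F \<longleftrightarrow> (\<exists>v. z = f v \<and> (u, v) \<in> F)" for F u z
    using f by (force simp: inj_def)
  have eq: "f u = f v \<longleftrightarrow> u = v" for u v
    using f by (simp add: inj_eq)
  have joined: "joined (map_prod f f ` F) (f x) (f y) \<longleftrightarrow> joined F x y" for F x y
    unfolding joined_def pre eq by (auto simp: mem eq)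
  have del: "map_prod f f ` E - {(f x, f y)} = map_prod f f ` (E - {(x, y)})" for x y
    using f by (auto simp: inj_def)
  have "arc_critical (map_prod f f ` E) (f x) (f y)" if "arc_critical E x y" for x y
    using that unfolding arc_critical_def del by (metis mem joined)
  then have "\<forall>(x, y)\<in>map_prod f f ` E. arc_critical (map_prod f f ` E) x y"
    using G unfolding critical_clique_def by fastforce
  with G show ?thesis
    unfolding critical_clique_def by (auto simp: joined irrefl_def antisym_def mem eq)
qed

section \<open>No deeply critical oriented clique of order 7\<close>

lemma critical_clique_asym:
  assumes "critical_clique V E" "(x, y) \<in> E" "(y, x) \<in> E"
  shows False
  using assms unfolding critical_clique_def irrefl_def by (metis antisymD)

text \<open>Turns the conditions on \<open>E\<close> without \<open>(x, y)\<close> into conditions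
  on \<open>E\<close>. As \<open>w \<noteq> y\<close> and \<open>w' \<noteq> x\<close>, the deleted
  arc can only be the first arc of a 2-dipath from \<open>x\<close> to \<open>w\<close> and the
  second of one from \<open>w'\<close> to \<open>y\<close>.\<close>

lemma critical_clique_arc:
  assumes G: "critical_clique V E" and xy: "(x, y) \<in> E"
  obtains w w' where "(y, w) \<in> E" "(w', x) \<in> E" "(w, w') \<notin> E"
    "(x, w) \<notin> E" "(w, x) \<notin> E" "(w', y) \<notin> E" "(y, w') \<notin> E"
    "\<And>z. (x, z) \<in> E \<Longrightarrow> (z, w) \<in> E \<Longrightarrow> z = y" "\<And>z. (w, z) \<in> E \<Longrightarrow> (z, x) \<notin> E"
    "\<And>z. (w', z) \<in> E \<Longrightarrow> (z, y) \<in> E \<Longrightarrow> z = x" "\<And>z. (y, z) \<in> E \<Longrightarrow> (z, w') \<notin> E"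
proof -
  note asym = critical_clique_asym[OF G]
  have "arc_critical E x y" using G xy by (auto simp: critical_clique_def)
  then obtain w w' where w: "(y, w) \<in> E" "(w', x) \<in> E" "(w, w') \<notin> E"
    "\<not> joined (E - {(x, y)}) x w" "\<not> joined (E - {(x, y)}) w' y"
    unfolding arc_critical_def by blast
  then have "w \<noteq> x" "w' \<noteq> y" "w \<noteq> y" "w' \<noteq> x" "x \<noteq> y" using asym xy by blast+
  with w show ?thesis
    unfolding joined_def by (intro that[of w w']) blast+
qed

section \<open>The bound on the number of arcs and vertices of low degree\<close>

text \<open>Inside \<open>V \<times> V\<close>, the arcs, their converses, the diagonal and both
  orders of the non-adjacent pair assigned to each arc are disjoint. The assignment is
  injective.\<close>

lemma critical_clique_card_arcs:
  assumes G: "critical_clique V E"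
  shows "4 * card E + card V \<le> card V * card V"
proof -
  have fin: "finite V" and sub: "E \<subseteq> V \<times> V"
    using G by (auto simp: critical_clique_def)
  note asym = critical_clique_asym[OF G]
  have finE: "finite E" using fin sub by (meson finite_SigmaI finite_subset)
  have "\<forall>e\<in>E. \<exists>w. (snd e, w) \<in> E \<and> (fst e, w) \<notin> E \<and> (w, fst e) \<notin> E \<and>
      (\<forall>z. (fst e, z) \<in> E \<longrightarrow> (z, w) \<in> E \<longrightarrow> z = snd e) \<and> (\<forall>z. (w, z) \<in> E \<longrightarrow> (z, fst e) \<notin> E)"
  proof
    fix e assume "e \<in> E"
    then have "(fst e, snd e) \<in> E" by simp
    from critical_clique_arc[OF G this] show "\<exists>w. (snd e, w) \<in> E \<and> (fst e, w) \<notin> E \<and> (w, fst e) \<notin> E \<and>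
      (\<forall>z. (fst e, z) \<in> E \<longrightarrow> (z, w) \<in> E \<longrightarrow> z = snd e) \<and> (\<forall>z. (w, z) \<in> E \<longrightarrow> (z, fst e) \<notin> E)"
      by metis
  qed
  from bchoice[OF this] obtain W where W: "\<And>e. e \<in> E \<Longrightarrow> (snd e, W e) \<in> E"
    and nonadj: "\<And>e. e \<in> E \<Longrightarrow> (fst e, W e) \<notin> E" "\<And>e. e \<in> E \<Longrightarrow> (W e, fst e) \<notin> E"
    and sole: "\<And>e z. e \<in> E \<Longrightarrow> (fst e, z) \<in> E \<Longrightarrow> (z, W e) \<in> E \<Longrightarrow> z = snd e"
    and one_way: "\<And>e z. e \<in> E \<Longrightarrow> (W e, z) \<in> E \<Longrightarrow> (z, fst e) \<in> E \<Longrightarrow> False"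
    by blast
  have path: "(fst e, snd e) \<in> E" "(snd e, W e) \<in> E" "fst e \<noteq> W e" if "e \<in> E" for e
  proof -
    show *: "(fst e, snd e) \<in> E" "(snd e, W e) \<in> E" using that W by auto
    show "fst e \<noteq> W e"
    proof
      assume "fst e = W e"
      with * show False using asym[of "fst e" "snd e"] by simp
    qed
  qed
  define f g where "f = (\<lambda>e. (fst e, W e))" and "g = (\<lambda>e. (W e, fst e))"
  \<comment> \<open>The arc is recovered from its pair: its head is the only middle vertex of a
    2-dipath from \<open>fst e\<close> to \<open>W e\<close>.\<close>
  have inj: "inj_on f E" "inj_on g E"
  proof -
    have "e = e'" if "e \<in> E" "e' \<in> E" "fst e = fst e'" "W e = W e'" for e e'
      using sole[of e "snd e'"] path[of e'] that by (simp add: prod_eq_iff)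
    then show "inj_on f E" "inj_on g E" by (auto simp: inj_on_def f_def g_def)
  qed
  \<comment> \<open>Two arcs giving the same pair in opposite orders would yield 2-dipaths both
    ways, against \<open>one_way\<close>.\<close>
  have disj: "f ` E \<inter> g ` E = {}"
  proof -
    have False if "e \<in> E" "e' \<in> E" "fst e = W e'" "W e = fst e'" for e e'
      using one_way[OF that(1), of "snd e'"] path[OF that(2)] that by simp
    then show ?thesis by (auto simp: f_def g_def)
  qed
  have "E \<inter> E\<inverse> = {}" using asym by auto
  moreover have "(E \<union> E\<inverse>) \<inter> (f ` E \<union> g ` E) = {}"
    using nonadj by (auto simp: f_def g_def)
  moreover have "(E \<union> E\<inverse> \<union> (f ` E \<union> g ` E)) \<inter> Id_on V = {}"
    using path(3) path(3)[symmetric] asym by (fastforce simp: f_def g_def)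
  moreover have pairs: "E \<union> E\<inverse> \<union> (f ` E \<union> g ` E) \<union> Id_on V \<subseteq> V \<times> V"
  proof -
    have "W e \<in> V" if "e \<in> E" for e using path(2)[OF that] sub by blast
    then show ?thesis using sub by (auto simp: f_def g_def)
  qed
  moreover have "card (Id_on V) = card V"
    unfolding Id_on_def by (simp add: card_UN_disjoint fin)
  moreover have "finite (Id_on V)" using fin by (simp add: Id_on_def)
  moreover have "card (f ` E) = card E" "card (g ` E) = card E"
    using inj by (simp_all add: card_image)
  moreover have "card (E\<inverse>) = card E" by simp
  ultimately have "card E + card E + (card E + card E) + card V = card (E \<union> E\<inverse> \<union> (f ` E \<union> g ` E) \<union> Id_on V)"
    using finE disj by (simp add: card_Un_disjoint)
  also have "\<dots> \<le> card (V \<times> V)"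
    using pairs fin by (intro card_mono) auto
  finally show ?thesis by (simp add: card_cartesian_product)
qed

text \<open>Being joined to another vertex puts \<open>v\<close> on some arc, and the witnesses of
  criticality prolong every arc at both ends.\<close>

lemma critical_clique_degrees_pos:
  assumes G: "critical_clique V E" and "E \<noteq> {}" "v \<in> V"
  shows "E `` {v} \<noteq> {}" "E\<inverse> `` {v} \<noteq> {}"
proof -
  obtain x y where xy: "(x, y) \<in> E" using assms by auto
  then have "x \<in> V" "y \<in> V" "x \<noteq> y" using G by (auto simp: critical_clique_def irrefl_def)
  then obtain u where "u \<in> V" "u \<noteq> v" using assms by metis
  then have "joined E v u" using G assms by (auto simp: critical_clique_def)
  then consider z where "(v, z) \<in> E" | z where "(z, v) \<in> E"
    unfolding joined_def by blast
  then have "(\<exists>z. (v, z) \<in> E) \<and> (\<exists>z. (z, v) \<in> E)"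
    by cases (use G in \<open>fastforce simp: critical_clique_def arc_critical_def\<close>)+
  then show "E `` {v} \<noteq> {}" "E\<inverse> `` {v} \<noteq> {}" by auto
qed

text \<open>At most 10 arcs give a degree sum of at most 20, less than \<open>3 * 7\<close>. Some
  vertex thus has in-degree plus out-degree at most 2, and both are positive.\<close>

lemma critical_clique_vertex_degree_2:
  assumes G: "critical_clique V E" and ne: "E \<noteq> {}" and V: "card V = 7"
  obtains v a b where "v \<in> V" "E `` {v} = {b}" "E\<inverse> `` {v} = {a}"
proof -
  have fin: "finite V" and sub: "E \<subseteq> V \<times> V"
    using G by (auto simp: critical_clique_def)
  then have finE: "finite E" by (meson finite_SigmaI finite_subset)
  have fd: "finite (E `` {v})" "finite (E\<inverse> `` {v})" for v
    using finE by (simp_all add: finite_Image)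
  have "card E = (\<Sum>v\<in>V. card (E `` {v}))"
  proof -
    have "E = Sigma V (\<lambda>v. E `` {v})" using sub by auto
    then show ?thesis using card_SigmaI[of V "\<lambda>v. E `` {v}"] fin fd by simp
  qed
  moreover have "card E = (\<Sum>v\<in>V. card (E\<inverse> `` {v}))"
  proof -
    have "E\<inverse> = Sigma V (\<lambda>v. E\<inverse> `` {v})" using sub by auto
    then show ?thesis using card_SigmaI[of V "\<lambda>v. E\<inverse> `` {v}"] fin fd by (metis card_inverse)
  qed
  ultimately have deg: "(\<Sum>v\<in>V. card (E `` {v}) + card (E\<inverse> `` {v})) = 2 * card E"
    by (simp add: sum.distrib)
  have "\<exists>v\<in>V. card (E `` {v}) + card (E\<inverse> `` {v}) \<le> 2"
  proof (rule ccontr)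
    assume "\<not> ?thesis"
    then have "(\<Sum>v\<in>V. 3) \<le> (\<Sum>v\<in>V. card (E `` {v}) + card (E\<inverse> `` {v}))"
      by (intro sum_mono) (metis not_less_eq_eq numeral_2_eq_2 numeral_3_eq_3)
    then have "21 \<le> 2 * card E" using deg V by simp
    moreover have "4 * card E \<le> 42"
      using critical_clique_card_arcs[OF G] V by simp
    ultimately show False by presburger
  qed
  then obtain v where v: "v \<in> V" "card (E `` {v}) + card (E\<inverse> `` {v}) \<le> 2" by blast
  moreover have "card (E `` {v}) \<noteq> 0" "card (E\<inverse> `` {v}) \<noteq> 0"
    using critical_clique_degrees_pos[OF G ne v(1)] fd by simp_all
  ultimately have "card (E `` {v}) = 1" "card (E\<inverse> `` {v}) = 1" by linarith+
  then show ?thesis using that v(1) by (metis card_1_singletonE)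
qed

section \<open>The exclusion of order 7\<close>

lemma no_critical_clique_7:
  assumes G: "critical_clique V E" and ne: "E \<noteq> {}" and V7: "card V = 7"
  shows False
proof -
  have fin: "finite V" and sub: "\<And>x y. (x, y) \<in> E \<Longrightarrow> x \<in> V \<and> y \<in> V"
    and J: "\<And>x y. x \<in> V \<Longrightarrow> y \<in> V \<Longrightarrow> x \<noteq> y \<Longrightarrow> joined E x y"
    using G by (auto simp: critical_clique_def)
  note asym = critical_clique_asym[OF G] and arcE = critical_clique_arc[OF G]
  obtain v a b where v: "v \<in> V" "E `` {v} = {b}" "E\<inverse> `` {v} = {a}"
    using critical_clique_vertex_degree_2[OF G ne V7] .
  then have out_v: "(v, z) \<in> E \<longleftrightarrow> z = b" and in_v: "(z, v) \<in> E \<longleftrightarrow> z = a" for z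
    by auto
  then have vb: "(v, b) \<in> E" and av: "(a, v) \<in> E" by blast+
  \<comment> \<open>As \<open>b\<close> is the only out-neighbour of \<open>v\<close>, the witness
    at the head of the arc \<open>(a, v)\<close> is \<open>b\<close>.\<close>
  obtain w where "(v, w) \<in> E" "(a, w) \<notin> E" "(w, a) \<notin> E" "\<And>z. (w, z) \<in> E \<Longrightarrow> (z, a) \<notin> E"
    using arcE[OF av] by metis
  then have ab: "(a, b) \<notin> E" "(b, a) \<notin> E" and no_ba: "\<And>z. (b, z) \<in> E \<Longrightarrow> (z, a) \<in> E \<Longrightarrow> False"
    by (auto simp: out_v)
  have dist: "a \<noteq> b" "a \<noteq> v" "b \<noteq> v" using vb av asym by blast+
  define C where "C = V - {v, a, b}"
  define A B where "A = {c\<in>C. (c, a) \<in> E}" and "B = {c\<in>C. (b, c) \<in> E}"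
  have AB: "A \<inter> B = {}" using no_ba by (auto simp: A_def B_def)
  \<comment> \<open>A vertex of \<open>C\<close> is not adjacent to \<open>v\<close>, so its
    connection with \<open>v\<close> passes through \<open>a\<close> or through
    \<open>b\<close>.\<close>
  have "C \<subseteq> A \<union> B"
  proof
    fix c assume c: "c \<in> C"
    then have "joined E c v" using J v by (auto simp: C_def)
    then show "c \<in> A \<union> B"
      using c unfolding joined_def in_v out_v by (auto simp: A_def B_def C_def in_v out_v)
  qed
  then have C: "C = A \<union> B" by (auto simp: A_def B_def)
  \<comment> \<open>\<open>d\<close> is the witness before the tail of the arc
    \<open>(c, a)\<close>. As \<open>c\<close> is the sole middle vertex from \<open>d\<close> to
    \<open>a\<close>, it is the only out-neighbour of \<open>d\<close> in \<open>A\<close>. The next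
    fact is the dual one, for the arc \<open>(b, d)\<close>.\<close>
  have A: "\<exists>d\<in>B. (d, c) \<in> E \<and> (\<forall>c'\<in>A. (d, c') \<in> E \<longrightarrow> c' = c) \<and> (a, d) \<notin> E" if c: "c \<in> A" for c
  proof -
    have ca: "(c, a) \<in> E" using c by (simp add: A_def)
    obtain d where d: "(d, c) \<in> E" "(d, a) \<notin> E" "(a, d) \<notin> E" "\<And>z. (d, z) \<in> E \<Longrightarrow> (z, a) \<in> E \<Longrightarrow> z = c"
      using arcE[OF ca] by metis
    have "d \<noteq> v" "d \<noteq> a" "d \<noteq> b"
      using c d(1) no_ba ca asym by (auto simp: out_v A_def C_def)
    then have "d \<in> C" using sub d(1) by (auto simp: C_def)
    moreover have "d \<notin> A" using d(2) by (simp add: A_def)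
    ultimately have "d \<in> B" using C by blast
    with d show ?thesis by (auto simp: A_def)
  qed
  have B: "\<exists>c\<in>A. (d, c) \<in> E \<and> (\<forall>d'\<in>B. (d', c) \<in> E \<longrightarrow> d' = d) \<and> (c, b) \<notin> E" if d: "d \<in> B" for d
  proof -
    have bd: "(b, d) \<in> E" using d by (simp add: B_def)
    obtain c where c: "(d, c) \<in> E" "(b, c) \<notin> E" "(c, b) \<notin> E" "\<And>z. (b, z) \<in> E \<Longrightarrow> (z, c) \<in> E \<Longrightarrow> z = d"
      using arcE[OF bd] by metis
    have "c \<noteq> v" "c \<noteq> a" "c \<noteq> b"
      using d c(1) no_ba bd asym by (auto simp: in_v B_def C_def)
    then have "c \<in> C" using sub c(1) by (auto simp: C_def)
    moreover have "c \<notin> B" using c(2) by (simp add: B_def)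
    ultimately have "c \<in> A" using C by blast
    with c show ?thesis by (auto simp: B_def)
  qed
  obtain \<delta> where \<delta>: "\<And>c. c \<in> A \<Longrightarrow> \<delta> c \<in> B \<and> (\<delta> c, c) \<in> E \<and> (\<forall>c'\<in>A. (\<delta> c, c') \<in> E \<longrightarrow> c' = c) \<and> (a, \<delta> c) \<notin> E"
    using A by metis
  obtain \<gamma> where \<gamma>: "\<And>d. d \<in> B \<Longrightarrow> \<gamma> d \<in> A \<and> (d, \<gamma> d) \<in> E \<and> (\<forall>d'\<in>B. (d', \<gamma> d) \<in> E \<longrightarrow> d' = d) \<and> (\<gamma> d, b) \<notin> E"
    using B by metis
  \<comment> \<open>The uniqueness clauses make the two maps inverse to each other, so the arcs from
    \<open>B\<close> to \<open>A\<close> form a perfect matching.\<close>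
  have \<delta>\<gamma>: "\<delta> (\<gamma> d) = d" if "d \<in> B" for d using \<delta> \<gamma> that by metis
  have \<gamma>\<delta>: "\<gamma> (\<delta> c) = c" if "c \<in> A" for c using \<delta> \<gamma> that by metis
  have finAB: "finite A" "finite B" using fin by (simp_all add: A_def B_def C_def)
  have "bij_betw \<delta> A B"
    using \<delta> \<gamma> \<delta>\<gamma> \<gamma>\<delta> by (intro bij_betw_byWitness[of _ \<gamma>]) auto
  then have "card A = card B" by (rule bij_betw_same_card)
  moreover have "card A + card B = 4"
  proof -
    have "card C = 4"
      using V7 v dist sub[OF av] sub[OF vb] fin by (simp add: C_def card_Diff_subset)
    then show ?thesis using C AB finAB by (simp add: card_Un_disjoint)
  qed
  ultimately have "card A = 2" by simp
  then obtain c1 c2 where A12: "A = {c1, c2}" "c1 \<noteq> c2" by (auto simp: card_2_iff)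
  have V: "z = v \<or> z = a \<or> z = b \<or> z \<in> A \<or> z \<in> B" if "z \<in> V" for z
    using that C unfolding C_def by blast
  \<comment> \<open>Outside \<open>A \<union> B\<close>, a vertex of \<open>A\<close> turns out to
    be adjacent only to \<open>a\<close> and a vertex of \<open>B\<close> only to \<open>b\<close>.
    The rest is decided among four vertices.\<close>
  have in_A: "(c, a) \<in> E" "(b, c) \<notin> E" "(c, b) \<notin> E" if "c \<in> A" for c
    using that \<gamma>[of "\<delta> c"] \<delta>[of c] \<gamma>\<delta>[of c] AB by (auto simp: A_def B_def)
  have in_B: "(b, d) \<in> E" "(d, a) \<notin> E" "(a, d) \<notin> E" if "d \<in> B" for d
    using that \<gamma>[of d] \<delta>[of "\<gamma> d"] \<delta>\<gamma>[of d] AB by (auto simp: A_def B_def)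
  have out_A: "z = a \<or> z \<in> A \<and> z \<noteq> c \<or> z \<in> B" if "c \<in> A" "(c, z) \<in> E" for c z
  proof -
    have "z \<in> V" "z \<noteq> c" using sub asym that(2) by blast+
    moreover have "z \<noteq> v" using that by (auto simp: in_v A_def C_def)
    moreover have "z \<noteq> b" using in_A[OF that(1)] that(2) by auto
    ultimately show ?thesis using V by blast
  qed
  have into_A: "z \<in> A \<and> z \<noteq> c \<or> z \<in> B" if "c \<in> A" "(z, c) \<in> E" for c z
  proof -
    have "z \<in> V" "z \<noteq> c" using sub asym that(2) by blast+
    moreover have "z \<noteq> v" using that by (auto simp: out_v A_def C_def)
    moreover have "z \<noteq> a" "z \<noteq> b" using in_A[OF that(1)] that(2) asym by blast+
    ultimately show ?thesis using V by blast
  qed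
  have out_B: "z \<in> A \<or> z \<in> B \<and> z \<noteq> d" if "d \<in> B" "(d, z) \<in> E" for d z
  proof -
    have "z \<in> V" "z \<noteq> d" using sub asym that(2) by blast+
    moreover have "z \<noteq> v" using that by (auto simp: in_v B_def C_def)
    moreover have "z \<noteq> a" "z \<noteq> b" using in_B[OF that(1)] that(2) asym by blast+
    ultimately show ?thesis using V by blast
  qed
  have into_B: "z = b \<or> z \<in> A \<or> z \<in> B \<and> z \<noteq> d" if "d \<in> B" "(z, d) \<in> E" for d z
  proof -
    have "z \<in> V" "z \<noteq> d" using sub asym that(2) by blast+
    moreover have "z \<noteq> v" using that by (auto simp: out_v B_def C_def)
    moreover have "z \<noteq> a" using in_B[OF that(1)] that(2) by auto
    ultimately show ?thesis using V by blast
  qed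
  have match: "B = {\<delta> c, \<delta> c'}" "c \<in> A" "c' \<in> A" "\<delta> c \<in> B" "\<delta> c' \<in> B" "\<delta> c \<noteq> \<delta> c'"
    "(\<delta> c, c) \<in> E" "(\<delta> c', c') \<in> E" "(\<delta> c, c') \<notin> E" "(\<delta> c', c) \<notin> E"
    if "A = {c, c'}" "c \<noteq> c'" for c c'
  proof -
    show *: "c \<in> A" "c' \<in> A" using that by auto
    show "B = {\<delta> c, \<delta> c'}" using \<open>bij_betw \<delta> A B\<close> that(1) by (auto simp: bij_betw_def)
    show "\<delta> c \<in> B" "\<delta> c' \<in> B" "(\<delta> c, c) \<in> E" "(\<delta> c', c') \<in> E" "(\<delta> c, c') \<notin> E" "(\<delta> c', c) \<notin> E"
      using \<delta>[OF *(1)] \<delta>[OF *(2)] * that(2) by blast+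
    then show "\<delta> c \<noteq> \<delta> c'" by metis
  qed
  \<comment> \<open>Exclusion leaves \<open>w = c'\<close> and \<open>w' = \<delta> c\<close> as
    witnesses for such an arc. Their non-adjacencies then leave \<open>c'\<close> and
    \<open>\<delta> c\<close> without any connection.\<close>
  have no_AB: "(c, \<delta> c') \<notin> E" if cc: "A = {c, c'}" "c \<noteq> c'" for c c'
  proof
    assume e: "(c, \<delta> c') \<in> E"
    note m = match[OF cc]
    obtain w w' where w: "(\<delta> c', w) \<in> E" "(w', c) \<in> E" "(w, w') \<notin> E" "(c, w) \<notin> E" "(w, c) \<notin> E"
      "(w', \<delta> c') \<notin> E" "(\<delta> c', w') \<notin> E"
      using arcE[OF e] by metis
    have "w \<in> {c, c', \<delta> c}" using out_B[OF m(5) w(1)] m(1) cc(1) by blast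
    then have "w = c'" using w(1,4,5) m by blast
    have "w' \<in> {c', \<delta> c, \<delta> c'}" using into_A[OF m(2) w(2)] m(1) cc(1) by blast
    then have "w' = \<delta> c" using w(2,5,6) m e \<open>w = c'\<close> asym by blast
    have n: "(c', \<delta> c) \<notin> E" "(c, c') \<notin> E" "(c', c) \<notin> E" "(\<delta> c, \<delta> c') \<notin> E" "(\<delta> c', \<delta> c) \<notin> E"
      using w \<open>w = c'\<close> \<open>w' = \<delta> c\<close> by simp_all
    have "c' \<in> V" "\<delta> c \<in> V" "c' \<noteq> \<delta> c" using m sub AB by blast+
    then obtain z where "(c', z) \<in> E \<and> (z, \<delta> c) \<in> E \<or> (\<delta> c, z) \<in> E \<and> (z, c') \<in> E"
      using J[of c' "\<delta> c"] n(1) m(9) unfolding joined_def by blast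
    then show False
    proof
      assume z: "(c', z) \<in> E \<and> (z, \<delta> c) \<in> E"
      then have "z \<in> {a, c, \<delta> c, \<delta> c'}" using out_A[OF m(3), of z] m(1) cc(1) by blast
      then show False using z n in_B(3)[OF m(4)] m(8) asym by blast
    next
      assume z: "(\<delta> c, z) \<in> E \<and> (z, c') \<in> E"
      then have "z \<in> {c, c', \<delta> c'}" using out_B[OF m(4), of z] m(1) cc(1) by blast
      then show False using z n m(9) asym by blast
    qed
  qed
  \<comment> \<open>The witness after \<open>c'\<close> must not be dominated by \<open>c\<close>.
    This excludes \<open>a\<close>, and the other candidates are not out-neighbours of
    \<open>c'\<close>.\<close>
  have no_A: "(c, c') \<notin> E" if cc: "A = {c, c'}" "c \<noteq> c'" for c c'
  proof
    assume e: "(c, c') \<in> E"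
    have cc': "A = {c', c}" using cc by auto
    note m = match[OF cc]
    obtain w where w: "(c', w) \<in> E" "(c, w) \<notin> E" using arcE[OF e] by metis
    have "w \<in> {a, c, \<delta> c, \<delta> c'}" using out_A[OF m(3) w(1)] m(1) cc(1) by blast
    then show False
      using w e in_A(1)[OF m(2)] no_AB[OF cc' cc(2)[symmetric]] m(8) asym by blast
  qed
  have A21: "A = {c2, c1}" "c2 \<noteq> c1" using A12 by auto
  note m = match[OF A12]
  have "c1 \<in> V" "c2 \<in> V" using m(7,8) sub by blast+
  \<comment> \<open>All out-neighbours of \<open>c1\<close> and \<open>c2\<close> are now reduced to
    \<open>a\<close>, which dominates neither, so the two vertices cannot be joined.\<close>
  then obtain z where "(c1, z) \<in> E \<and> (z, c2) \<in> E \<or> (c2, z) \<in> E \<and> (z, c1) \<in> E"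
    using J[of c1 c2] A12(2) no_A[OF A12] no_A[OF A21] unfolding joined_def by blast
  then show False
  proof
    assume z: "(c1, z) \<in> E \<and> (z, c2) \<in> E"
    then have "z \<in> {a, c2, \<delta> c1, \<delta> c2}" using out_A[OF m(2), of z] m(1) A12(1) by blast
    then show False using z no_A[OF A12] no_AB[OF A12] in_A(1)[OF m(3)] m(7) asym by blast
  next
    assume z: "(c2, z) \<in> E \<and> (z, c1) \<in> E"
    then have "z \<in> {a, c1, \<delta> c1, \<delta> c2}" using out_A[OF m(3), of z] m(1) A12(1) by blast
    then show False using z no_A[OF A21] no_AB[OF A21] in_A(1)[OF m(2)] m(8) asym by blast
  qed
qed

section \<open>Constructions\<close>

text \<open>With two vertices to be joined there is an arc, so the graph is not the degenerate one
  without arcs.\<close>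

lemma deeply_critical_oriented_clique_nat:
  fixes E :: "'a::countable rel"
  assumes G: "critical_clique V E" and n: "card V = n" and V: "2 \<le> n"
  shows "\<exists>G :: nat pair_pre_digraph. deeply_critical_oriented_clique G \<and>
    parcs G \<noteq> {} \<and> card (pverts G) = n"
proof (intro exI conjI)
  let ?G = "\<lparr>pverts = to_nat ` V, parcs = map_prod to_nat to_nat ` E\<rparr>"
  show "deeply_critical_oriented_clique ?G"
    using critical_clique_image[OF inj_to_nat G]
    by (simp add: deeply_critical_oriented_clique_iff)
  obtain x y where "x \<in> V" "y \<in> V" "x \<noteq> y"
    using V n by (metis card_2_iff' obtain_subset_with_card_n subset_iff)
  then have "joined E x y" using G by (simp add: critical_clique_def)
  then have "E \<noteq> {}" by (auto simp: joined_def)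
  then show "parcs ?G \<noteq> {}" by simp
  show "card (pverts ?G) = n" by (simp add: n card_image inj_on_subset[OF inj_to_nat])
qed

section \<open>A criterion for concrete graphs\<close>

text \<open>The demands of \<open>arc_critical\<close> on \<open>w\<close> and \<open>w'\<close>,
  with every quantifier bounded by \<open>V\<close>, so that simplification can decide them on
  explicit vertex sets.\<close>

definition arc_witness :: "'a set \<Rightarrow> ('a \<Rightarrow> 'a \<Rightarrow> bool) \<Rightarrow> 'a \<Rightarrow> 'a \<Rightarrow> 'a \<Rightarrow> 'a \<Rightarrow> bool" where
  "arc_witness V r x y w w' \<longleftrightarrow> w \<in> V \<and> w' \<in> V \<and> r y w \<and> r w' x \<and> \<not> r w w' \<and>
     \<not> r x w \<and> \<not> r w x \<and> \<not> r y w' \<and> \<not> r w' y \<and>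
     (\<forall>z\<in>V. (r x z \<longrightarrow> r z w \<longrightarrow> z = y) \<and> (r w' z \<longrightarrow> r z y \<longrightarrow> z = x) \<and>
       \<not> (r w z \<and> r z x) \<and> \<not> (r y z \<and> r z w'))"

definition induced :: "'a set \<Rightarrow> ('a \<Rightarrow> 'a \<Rightarrow> bool) \<Rightarrow> 'a rel" where
  "induced V r = {(x, y). x \<in> V \<and> y \<in> V \<and> r x y}"

lemma critical_clique_induced:
  assumes "finite V"
    and asym: "\<forall>x\<in>V. \<forall>y\<in>V. r x y \<longrightarrow> \<not> r y x"
    and joined: "\<forall>x\<in>V. \<forall>y\<in>V. x = y \<or> r x y \<or> r y x \<or> (\<exists>z\<in>V. r x z \<and> r z y) \<or> (\<exists>z\<in>V. r y z \<and> r z x)"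
    and crit: "\<forall>x\<in>V. \<forall>y\<in>V. r x y \<longrightarrow> (\<exists>w\<in>V. \<exists>w'\<in>V. arc_witness V r x y w w')"
  shows "critical_clique V (induced V r)"
proof -
  let ?E = "induced V r"
  have "arc_critical ?E x y" if xy: "x \<in> V" "y \<in> V" "r x y" for x y
  proof -
    obtain w w' where w: "arc_witness V r x y w w'"
      using crit xy by blast
    then have "\<not> joined (?E - {(x, y)}) x w" "\<not> joined (?E - {(x, y)}) w' y"
      unfolding arc_witness_def joined_def induced_def by blast+
    moreover have "(y, w) \<in> ?E" "(w', x) \<in> ?E" "(w, w') \<notin> ?E"
      using w xy unfolding arc_witness_def induced_def by blast+
    ultimately show ?thesis unfolding arc_critical_def by blast
  qed
  then have "\<forall>(x, y)\<in>?E. arc_critical ?E x y"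
    by (auto simp: induced_def)
  moreover have "irrefl ?E" "antisym ?E" "?E \<subseteq> V \<times> V"
    unfolding induced_def irrefl_def antisym_def using asym by blast+
  moreover have "\<forall>x\<in>V. \<forall>y\<in>V. x \<noteq> y \<longrightarrow> joined ?E x y"
    using joined unfolding joined_def induced_def by blast
  ultimately show ?thesis
    using assms(1) unfolding critical_clique_def by blast
qed

section \<open>Explicit graphs of orders 5, 9 and 11\<close>

text \<open>Vertices are integers because the simplifier rewrites \<open>1 :: nat\<close> to \<open>Suc 0\<close>, which the tables would miss.\<close>

definition out5 :: "int \<Rightarrow> int set" where
  "out5 x = [{1}, {2}, {3}, {4}, {0}] ! nat x"

lemma out5_simps [simp]:
  "out5 0 = {1}" "out5 1 = {2}" "out5 2 = {3}" "out5 3 = {4}" "out5 4 = {0}"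
  by (simp_all add: out5_def)

text \<open>The graph is the directed 5-cycle. The witnesses for the arc from \<open>x\<close> to
  \<open>x + 1\<close> are \<open>x + 2\<close> and \<open>x - 1\<close> modulo 5.\<close>

lemma critical_clique_5:
  fixes V :: "int set"
  defines "V \<equiv> {0, 1, 2, 3, 4}"
  shows "critical_clique V (induced V (\<lambda>x y. y \<in> out5 x))"
proof (rule critical_clique_induced)
  show "finite V" by (simp add: V_def)
  show "\<forall>x\<in>V. \<forall>y\<in>V. y \<in> out5 x \<longrightarrow> x \<notin> out5 y"
    unfolding V_def by (simp only: ball_simps) simp
  show "\<forall>x\<in>V. \<forall>y\<in>V. x = y \<or> y \<in> out5 x \<or> x \<in> out5 y \<or>
     (\<exists>z\<in>V. z \<in> out5 x \<and> y \<in> out5 z) \<or> (\<exists>z\<in>V. z \<in> out5 y \<and> x \<in> out5 z)"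
    unfolding V_def by (simp only: ball_simps bex_simps) simp
  let ?W = "arc_witness V (\<lambda>x y. y \<in> out5 x)"
  have W:
    "?W 0 1 2 4" "?W 1 2 3 0" "?W 2 3 4 1" "?W 3 4 0 2" "?W 4 0 1 3"
    unfolding V_def arc_witness_def by (simp_all only: ball_simps, simp_all)
  have "\<exists>w w'. ?W x y w w'" if "x \<in> V" "y \<in> out5 x" for x y
  proof -
    have "x = 0 \<or> x = 1 \<or> x = 2 \<or> x = 3 \<or> x = 4"
      using that(1) by (simp add: V_def)
    then show ?thesis
      using that(2) W by (elim disjE; hypsubst) (simp_all, blast+)
  qed
  then show "\<forall>x\<in>V. \<forall>y\<in>V. y \<in> out5 x \<longrightarrow> (\<exists>w\<in>V. \<exists>w'\<in>V. ?W x y w w')"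
    unfolding arc_witness_def by blast
qed

text \<open>The permutation (0 1 2)(3 4 5)(6 7 8) is an automorphism. The 15 arcs fall into five
  orbits under it, and the witnesses used below follow the same symmetry.\<close>

definition out9 :: "int \<Rightarrow> int set" where
  "out9 x = [{4, 6}, {5, 7}, {3, 8}, {5, 6}, {3, 7}, {4, 8}, {1}, {2}, {0}] ! nat x"

lemma out9_simps [simp]:
  "out9 0 = {4, 6}" "out9 1 = {5, 7}" "out9 2 = {3, 8}" "out9 3 = {5, 6}" "out9 4 = {3, 7}"
  "out9 5 = {4, 8}" "out9 6 = {1}" "out9 7 = {2}" "out9 8 = {0}"
  by (simp_all add: out9_def)

lemma critical_clique_9:
  fixes V :: "int set"
  defines "V \<equiv> {0, 1, 2, 3, 4, 5, 6, 7, 8}"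
  shows "critical_clique V (induced V (\<lambda>x y. y \<in> out9 x))"
proof (rule critical_clique_induced)
  show "finite V" by (simp add: V_def)
  show "\<forall>x\<in>V. \<forall>y\<in>V. y \<in> out9 x \<longrightarrow> x \<notin> out9 y"
    unfolding V_def by (simp only: ball_simps) simp
  show "\<forall>x\<in>V. \<forall>y\<in>V. x = y \<or> y \<in> out9 x \<or> x \<in> out9 y \<or>
     (\<exists>z\<in>V. z \<in> out9 x \<and> y \<in> out9 z) \<or> (\<exists>z\<in>V. z \<in> out9 y \<and> x \<in> out9 z)"
    unfolding V_def by (simp only: ball_simps bex_simps) simp
  let ?W = "arc_witness V (\<lambda>x y. y \<in> out9 x)"
  have W:
    "?W 0 4 3 8" "?W 0 6 1 8" "?W 1 5 4 6" "?W 1 7 2 6" "?W 2 3 5 7" "?W 2 8 0 7" "?W 3 5 8 2"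
    "?W 3 6 1 2" "?W 4 3 6 0" "?W 4 7 2 0" "?W 5 4 7 1" "?W 5 8 0 1" "?W 6 1 5 0" "?W 7 2 3 1"
    "?W 8 0 4 2"
    unfolding V_def arc_witness_def by (simp_all only: ball_simps, simp_all)
  have "\<exists>w w'. ?W x y w w'" if "x \<in> V" "y \<in> out9 x" for x y
  proof -
    have "x = 0 \<or> x = 1 \<or> x = 2 \<or> x = 3 \<or> x = 4 \<or> x = 5 \<or> x = 6 \<or> x = 7 \<or> x = 8"
      using that(1) by (simp add: V_def)
    then show ?thesis
      using that(2) W by (elim disjE; hypsubst) (simp_all, blast+)
  qed
  then show "\<forall>x\<in>V. \<forall>y\<in>V. y \<in> out9 x \<longrightarrow> (\<exists>w\<in>V. \<exists>w'\<in>V. ?W x y w w')"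
    unfolding arc_witness_def by blast
qed

text \<open>The circulant graph modulo 11 with steps 1 and 3. An arc of step \<open>s\<close>
  leaving \<open>x\<close> has the witnesses \<open>x + 2 * s\<close> and
  \<open>x - s\<close>.\<close>

definition out11 :: "int \<Rightarrow> int set" where
  "out11 x = [{1, 3}, {2, 4}, {3, 5}, {4, 6}, {5, 7}, {6, 8}, {7, 9}, {8, 10}, {0, 9}, {1, 10}, {0, 2}] ! nat x"

lemma out11_simps [simp]:
  "out11 0 = {1, 3}" "out11 1 = {2, 4}" "out11 2 = {3, 5}" "out11 3 = {4, 6}" "out11 4 = {5, 7}"
  "out11 5 = {6, 8}" "out11 6 = {7, 9}" "out11 7 = {8, 10}" "out11 8 = {0, 9}"
  "out11 9 = {1, 10}" "out11 10 = {0, 2}"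
  by (simp_all add: out11_def)

lemma critical_clique_11:
  fixes V :: "int set"
  defines "V \<equiv> {0, 1, 2, 3, 4, 5, 6, 7, 8, 9, 10}"
  shows "critical_clique V (induced V (\<lambda>x y. y \<in> out11 x))"
proof (rule critical_clique_induced)
  show "finite V" by (simp add: V_def)
  show "\<forall>x\<in>V. \<forall>y\<in>V. y \<in> out11 x \<longrightarrow> x \<notin> out11 y"
    unfolding V_def by (simp only: ball_simps) simp
  show "\<forall>x\<in>V. \<forall>y\<in>V. x = y \<or> y \<in> out11 x \<or> x \<in> out11 y \<or>
     (\<exists>z\<in>V. z \<in> out11 x \<and> y \<in> out11 z) \<or> (\<exists>z\<in>V. z \<in> out11 y \<and> x \<in> out11 z)"
    unfolding V_def by (simp only: ball_simps bex_simps) simp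
  let ?W = "arc_witness V (\<lambda>x y. y \<in> out11 x)"
  have W:
    "?W 0 1 2 10" "?W 0 3 6 8" "?W 1 2 3 0" "?W 1 4 7 9" "?W 2 3 4 1" "?W 2 5 8 10" "?W 3 4 5 2"
    "?W 3 6 9 0" "?W 4 5 6 3" "?W 4 7 10 1" "?W 5 6 7 4" "?W 5 8 0 2" "?W 6 7 8 5" "?W 6 9 1 3"
    "?W 7 8 9 6" "?W 7 10 2 4" "?W 8 0 3 5" "?W 8 9 10 7" "?W 9 1 4 6" "?W 9 10 0 8"
    "?W 10 0 1 9" "?W 10 2 5 7"
    unfolding V_def arc_witness_def by (simp_all only: ball_simps, simp_all)
  have "\<exists>w w'. ?W x y w w'" if "x \<in> V" "y \<in> out11 x" for x y
  proof -
    have "x = 0 \<or> x = 1 \<or> x = 2 \<or> x = 3 \<or> x = 4 \<or> x = 5 \<or> x = 6 \<or> x = 7 \<or> x = 8 \<or> x = 9 \<or> x = 10"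
      using that(1) by (simp add: V_def)
    then show ?thesis
      using that(2) W by (elim disjE; hypsubst) (simp_all, blast+)
  qed
  then show "\<forall>x\<in>V. \<forall>y\<in>V. y \<in> out11 x \<longrightarrow> (\<exists>w\<in>V. \<exists>w'\<in>V. ?W x y w w')"
    unfolding arc_witness_def by blast
qed

section \<open>Layered graphs of orders 4k + 1 and 4k + 3\<close>

datatype vertex = A nat | B nat | C nat | D nat | H nat

instance vertex :: countable
  by countable_datatype

definition layers :: "nat set \<Rightarrow> nat set \<Rightarrow> vertex set" where
  "layers I J = A ` I \<union> B ` I \<union> C ` I \<union> D ` I \<union> H ` J"

lemma mem_layers [simp]:
  "A i \<in> layers I J \<longleftrightarrow> i \<in> I" "B i \<in> layers I J \<longleftrightarrow> i \<in> I" "C i \<in> layers I J \<longleftrightarrow> i \<in> I"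
  "D i \<in> layers I J \<longleftrightarrow> i \<in> I" "H i \<in> layers I J \<longleftrightarrow> i \<in> J"
  by (auto simp: layers_def)

lemma ball_layers:
  "(\<forall>v\<in>layers I J. P v) \<longleftrightarrow> (\<forall>i\<in>I. P (A i) \<and> P (B i) \<and> P (C i) \<and> P (D i)) \<and> (\<forall>j\<in>J. P (H j))"
  unfolding layers_def by blast

lemma bex_layers:
  "(\<exists>v\<in>layers I J. P v) \<longleftrightarrow> (\<exists>i\<in>I. P (A i) \<or> P (B i) \<or> P (C i) \<or> P (D i)) \<or> (\<exists>j\<in>J. P (H j))"
  unfolding layers_def by blast

lemma finite_layers: "finite I \<Longrightarrow> finite J \<Longrightarrow> finite (layers I J)"
  by (simp add: layers_def)

lemma card_layers: "finite I \<Longrightarrow> finite J \<Longrightarrow> card (layers I J) = 4 * card I + card J"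
  unfolding layers_def
  by (subst card_Un_disjoint, auto simp: card_image inj_on_def)+

text \<open>
  The arc patterns \<open>arc1\<close>, \<open>arc2\<close> and their witnesses come from a computer search over patterns in
  which two copies are linked according to the orientation of the pair of indices only.
\<close>

locale proper_tournament =
  fixes I :: "nat set" and T :: "nat \<Rightarrow> nat \<Rightarrow> bool"
  assumes finite_index: "finite I" and index_nonempty: "I \<noteq> {}"
    and T_asym: "T i j \<Longrightarrow> T j i \<Longrightarrow> False"
    and T_total: "i \<in> I \<Longrightarrow> j \<in> I \<Longrightarrow> i \<noteq> j \<Longrightarrow> T i j \<or> T j i"
    and T_out: "i \<in> I \<Longrightarrow> \<exists>j\<in>I. T i j"
    and T_in: "i \<in> I \<Longrightarrow> \<exists>j\<in>I. T j i"
begin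

lemma T_irrefl [simp]: "\<not> T i i"
  using T_asym by blast

fun arc1 :: "vertex \<Rightarrow> vertex \<Rightarrow> bool" where
  "arc1 (A i) (B j) \<longleftrightarrow> i = j"
| "arc1 (B i) (A j) \<longleftrightarrow> T i j"
| "arc1 (B i) (C j) \<longleftrightarrow> T j i"
| "arc1 (B i) (D j) \<longleftrightarrow> i = j"
| "arc1 (C i) (A j) \<longleftrightarrow> i = j"
| "arc1 (C i) (D j) \<longleftrightarrow> i = j"
| "arc1 (D i) (A j) \<longleftrightarrow> T j i"
| "arc1 (D i) (C j) \<longleftrightarrow> T i j"
| "arc1 (D i) (H j) \<longleftrightarrow> True"
| "arc1 (H i) (C j) \<longleftrightarrow> True"
| "arc1 _ _ \<longleftrightarrow> False"

lemma arc1_asym: "arc1 x y \<Longrightarrow> arc1 y x \<Longrightarrow> False"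
  by (cases x; cases y) (auto elim: T_asym)

lemma critical_clique_4k1:
  defines "V \<equiv> layers I {0}"
  shows "critical_clique V (induced V arc1)"
proof (rule critical_clique_induced)
  show "finite V" by (simp add: V_def finite_layers finite_index)
  show "\<forall>x\<in>V. \<forall>y\<in>V. arc1 x y \<longrightarrow> \<not> arc1 y x"
    using arc1_asym by blast
  show "\<forall>x\<in>V. \<forall>y\<in>V. x = y \<or> arc1 x y \<or> arc1 y x \<or>
    (\<exists>z\<in>V. arc1 x z \<and> arc1 z y) \<or> (\<exists>z\<in>V. arc1 y z \<and> arc1 z x)"
    (is "\<forall>x\<in>V. \<forall>y\<in>V. ?J x y")
  proof (intro ballI)
    fix x y assume "x \<in> V" "y \<in> V"
    then show "?J x y"
      by (cases x; cases y) (auto simp: V_def bex_layers dest: T_total)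
  qed
  show "\<forall>x\<in>V. \<forall>y\<in>V. arc1 x y \<longrightarrow> (\<exists>w\<in>V. \<exists>w'\<in>V. arc_witness V arc1 x y w w')"
    (is "\<forall>x\<in>V. \<forall>y\<in>V. arc1 x y \<longrightarrow> ?W x y")
  proof (intro ballI impI)
    fix x y assume xy: "x \<in> V" "y \<in> V" "arc1 x y"
    then show "?W x y"
    proof (cases rule: arc1.cases[of "(x, y)"])
      case (1 i j)
      with xy show ?thesis
        unfolding V_def by (intro bexI[of _ "D i"] bexI[of _ "C i"]) (auto simp: arc_witness_def ball_layers elim: T_asym)
    next
      case (2 i j)
      with xy show ?thesis
        unfolding V_def by (intro bexI[of _ "B j"] bexI[of _ "A i"]) (auto simp: arc_witness_def ball_layers elim: T_asym)
    next
      case (3 i j)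
      with xy show ?thesis
        unfolding V_def by (intro bexI[of _ "D j"] bexI[of _ "A i"]) (auto simp: arc_witness_def ball_layers elim: T_asym)
    next
      case (4 i j)
      with xy show ?thesis
        unfolding V_def by (intro bexI[of _ "H 0"] bexI[of _ "A i"]) (auto simp: arc_witness_def ball_layers elim: T_asym)
    next
      case (5 i j)
      with xy show ?thesis
        unfolding V_def by (intro bexI[of _ "B i"] bexI[of _ "H 0"]) (auto simp: arc_witness_def ball_layers elim: T_asym)
    next
      case (6 i j)
      \<comment> \<open>\<open>D i\<close> dominates \<open>A l\<close>, and \<open>D l\<close>
        dominates \<open>C i\<close>, exactly when \<open>T l i\<close>. The absence of sources
        provides such an \<open>l\<close>.\<close>
      with xy obtain l where "l \<in> I" "T l i" using T_in unfolding V_def by auto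
      with 6 xy show ?thesis
        unfolding V_def by (intro bexI[of _ "A l"] bexI[of _ "D l"]) (auto simp: arc_witness_def ball_layers elim: T_asym)
    next
      case (7 i j)
      with xy show ?thesis
        unfolding V_def by (intro bexI[of _ "B j"] bexI[of _ "C i"]) (auto simp: arc_witness_def ball_layers elim: T_asym)
    next
      case (8 i j)
      with xy show ?thesis
        unfolding V_def by (intro bexI[of _ "A j"] bexI[of _ "B i"]) (auto simp: arc_witness_def ball_layers elim: T_asym)
    next
      case (9 i j)
      with xy obtain l where "l \<in> I" "T l i" using T_in unfolding V_def by auto
      with 9 xy show ?thesis
        unfolding V_def by (intro bexI[of _ "C l"] bexI[of _ "B i"]) (auto simp: arc_witness_def ball_layers elim: T_asym)
    next
      case (10 i j)
      \<comment> \<open>\<open>D l\<close> dominates \<open>C j\<close> if \<open>T l j\<close> and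
        is dominated by it if \<open>l = j\<close>. With \<open>T j l\<close> the two are
        non-adjacent, and the absence of sinks provides such an \<open>l\<close>.\<close>
      with xy obtain l where "l \<in> I" "T j l" using T_out unfolding V_def by auto
      with 10 xy show ?thesis
        unfolding V_def by (intro bexI[of _ "A j"] bexI[of _ "D l"]) (auto simp: arc_witness_def ball_layers elim: T_asym)
    qed (use xy in auto)
  qed
qed

fun arc2 :: "vertex \<Rightarrow> vertex \<Rightarrow> bool" where
  "arc2 (A i) (B j) \<longleftrightarrow> i = j"
| "arc2 (B i) (A j) \<longleftrightarrow> T j i"
| "arc2 (B i) (C j) \<longleftrightarrow> i \<noteq> j"
| "arc2 (C i) (A j) \<longleftrightarrow> i = j"
| "arc2 (C i) (D j) \<longleftrightarrow> i = j"
| "arc2 (D i) (B j) \<longleftrightarrow> i = j"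
| "arc2 (D i) (C j) \<longleftrightarrow> T j i"
| "arc2 (A i) (H j) \<longleftrightarrow> j = 1"
| "arc2 (H i) (A j) \<longleftrightarrow> i = 2"
| "arc2 (H i) (D j) \<longleftrightarrow> i = 0"
| "arc2 (D i) (H j) \<longleftrightarrow> j = 2"
| "arc2 (H i) (H j) \<longleftrightarrow> i = 1 \<and> j = 0"
| "arc2 _ _ \<longleftrightarrow> False"

lemma arc2_asym: "arc2 x y \<Longrightarrow> arc2 y x \<Longrightarrow> False"
  by (cases x; cases y) (auto elim: T_asym)

lemma critical_clique_4k3:
  defines "V \<equiv> layers I {0, 1, 2}"
  shows "critical_clique V (induced V arc2)"
proof (rule critical_clique_induced)
  show "finite V" by (simp add: V_def finite_layers finite_index)
  show "\<forall>x\<in>V. \<forall>y\<in>V. arc2 x y \<longrightarrow> \<not> arc2 y x"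
    using arc2_asym by blast
  show "\<forall>x\<in>V. \<forall>y\<in>V. x = y \<or> arc2 x y \<or> arc2 y x \<or>
    (\<exists>z\<in>V. arc2 x z \<and> arc2 z y) \<or> (\<exists>z\<in>V. arc2 y z \<and> arc2 z x)"
    (is "\<forall>x\<in>V. \<forall>y\<in>V. ?J x y")
  proof (intro ballI)
    fix x y assume "x \<in> V" "y \<in> V"
    then show "?J x y"
      \<comment> \<open>\<open>B i\<close> is joined to \<open>H 1\<close> through an
        \<open>A j\<close> with \<open>T j i\<close>, and \<open>H 0\<close> to \<open>C i\<close>
        through a \<open>D j\<close> with \<open>T i j\<close>. The connections of
        \<open>H 2\<close> with \<open>H 0\<close> and \<open>H 1\<close> pass through some copy of
        an index.\<close>
      using T_out T_in index_nonempty by (cases x; cases y) (auto simp: V_def bex_layers dest: T_total)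
  qed
  show "\<forall>x\<in>V. \<forall>y\<in>V. arc2 x y \<longrightarrow> (\<exists>w\<in>V. \<exists>w'\<in>V. arc_witness V arc2 x y w w')"
    (is "\<forall>x\<in>V. \<forall>y\<in>V. arc2 x y \<longrightarrow> ?W x y")
  proof (intro ballI impI)
    fix x y assume xy: "x \<in> V" "y \<in> V" "arc2 x y"
    then show "?W x y"
    proof (cases rule: arc2.cases[of "(x, y)"])
      case (1 i j)
      with xy obtain l where "l \<in> I" "T l i" using T_in unfolding V_def by auto
      with 1 xy show ?thesis
        unfolding V_def by (intro bexI[of _ "C l"] bexI[of _ "H 2"]) (auto simp: arc_witness_def ball_layers elim: T_asym)
    next
      case (2 i j)
      with xy show ?thesis
        unfolding V_def by (intro bexI[of _ "B j"] bexI[of _ "A i"]) (auto simp: arc_witness_def ball_layers elim: T_asym)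
    next
      case (3 i j)
      with xy show ?thesis
        unfolding V_def by (intro bexI[of _ "D j"] bexI[of _ "A i"]) (auto simp: arc_witness_def ball_layers elim: T_asym)
    next
      case (4 i j)
      \<comment> \<open>\<open>B l\<close> dominates \<open>C i\<close> for every
        \<open>l \<noteq> i\<close>, but it must not dominate \<open>A i\<close>, which it does when
        \<open>T i l\<close>.\<close>
      with xy obtain l where "l \<in> I" "T l i" using T_in unfolding V_def by auto
      with 4 xy show ?thesis
        unfolding V_def by (intro bexI[of _ "H 1"] bexI[of _ "B l"]) (auto simp: arc_witness_def ball_layers elim: T_asym)
    next
      case (5 i j)
      with xy obtain l where "l \<in> I" "T l i" using T_in unfolding V_def by auto
      with 5 xy show ?thesis
        unfolding V_def by (intro bexI[of _ "H 2"] bexI[of _ "B l"]) (auto simp: arc_witness_def ball_layers elim: T_asym)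
    next
      case (6 i j)
      with xy obtain l where "l \<in> I" "T i l" using T_out unfolding V_def by auto
      with 6 xy show ?thesis
        unfolding V_def by (intro bexI[of _ "C l"] bexI[of _ "H 0"]) (auto simp: arc_witness_def ball_layers elim: T_asym)
    next
      case (7 i j)
      with xy show ?thesis
        unfolding V_def by (intro bexI[of _ "D j"] bexI[of _ "C i"]) (auto simp: arc_witness_def ball_layers elim: T_asym)
    next
      case (8 i j)
      with xy show ?thesis
        unfolding V_def by (intro bexI[of _ "H 0"] bexI[of _ "C i"]) (auto simp: arc_witness_def ball_layers elim: T_asym)
    next
      case (9 i j)
      with xy show ?thesis
        unfolding V_def by (intro bexI[of _ "B j"] bexI[of _ "D j"]) (auto simp: arc_witness_def ball_layers elim: T_asym)
    next
      case (10 i j)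
      with xy show ?thesis
        unfolding V_def by (intro bexI[of _ "B j"] bexI[of _ "H 1"]) (auto simp: arc_witness_def ball_layers elim: T_asym)
    next
      case (11 i j)
      with xy show ?thesis
        unfolding V_def by (intro bexI[of _ "A i"] bexI[of _ "C i"]) (auto simp: arc_witness_def ball_layers elim: T_asym)
    next
      case (12 i j)
      with xy obtain l where "l \<in> I" using index_nonempty unfolding V_def by auto
      with 12 xy show ?thesis
        unfolding V_def by (intro bexI[of _ "D l"] bexI[of _ "A l"]) (auto simp: arc_witness_def ball_layers elim: T_asym)
    qed (use xy in auto)
  qed
qed

end

section \<open>A suitable tournament and the classification of odd orders\<close>

text \<open>This is the transitive tournament with the arc between its source \<open>0\<close> and
  its sink \<open>k - 1\<close> reversed, so that no source or sink remains.\<close>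

lemma proper_tournament_cyclic:
  assumes "k \<ge> 3"
  shows "proper_tournament {..<k} (\<lambda>i j. i < j \<and> (i, j) \<noteq> (0, k - 1) \<or> (j, i) = (0, k - 1))"
    (is "proper_tournament _ ?T")
proof
  show "{..<k} \<noteq> {}" using assms by (simp add: lessThan_empty_iff)
next
  fix i assume "i \<in> {..<k}"
  then consider "i = 0" | "0 < i" "i < k - 1" | "i = k - 1" by fastforce
  then have "(\<exists>j\<in>{..<k}. ?T i j) \<and> (\<exists>j\<in>{..<k}. ?T j i)"
  proof cases
    case 1
    with assms show ?thesis by (intro conjI bexI[of _ 1] bexI[of _ "k - 1"]) auto
  next
    case 2
    then show ?thesis by (intro conjI bexI[of _ 0] bexI[of _ "k - 1"]) auto
  next
    case 3
    with assms show ?thesis by (intro conjI bexI[of _ 0] bexI[of _ 1]) auto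
  qed
  then show "\<exists>j\<in>{..<k}. ?T i j" "\<exists>j\<in>{..<k}. ?T j i" by blast+
qed (use assms in auto)

text \<open>The witnesses of any arc extend it to a directed path \<open>w' x y w\<close>. Its ends
  differ because \<open>w'\<close> dominates \<open>x\<close> and \<open>w\<close> does not.\<close>

lemma critical_clique_card_ge_4:
  assumes G: "critical_clique V E" and "E \<noteq> {}"
  shows "4 \<le> card V"
proof -
  note asym = critical_clique_asym[OF G]
  obtain x y where xy: "(x, y) \<in> E" using assms(2) by auto
  obtain w w' where w: "(y, w) \<in> E" "(w', x) \<in> E" "(w, x) \<notin> E"
    using critical_clique_arc[OF G xy] by metis
  then have "distinct [w', x, y, w]"
    using xy asym by auto
  then have "card {w', x, y, w} = 4"
    using distinct_card[of "[w', x, y, w]"] by simp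
  moreover have "{w', x, y, w} \<subseteq> V" "finite V"
    using G xy w by (auto simp: critical_clique_def)
  ultimately show ?thesis by (metis card_mono)
qed

theorem theorem3:
  fixes n :: nat
  assumes "n \<ge> 1" and "odd n"
  shows "(\<exists>G :: nat pair_pre_digraph. deeply_critical_oriented_clique G \<and>
            parcs G \<noteq> {} \<and> card (pverts G) = n) \<longleftrightarrow> n \<ge> 5 \<and> n \<noteq> 7"
    (is "?L \<longleftrightarrow> ?R")
proof
  assume ?L
  then obtain G :: "nat pair_pre_digraph" where G: "critical_clique (pverts G) (parcs G)"
    "parcs G \<noteq> {}" "card (pverts G) = n"
    by (auto simp: deeply_critical_oriented_clique_iff)
  have "n \<ge> 4" using critical_clique_card_ge_4[OF G(1,2)] G(3) by simp
  moreover have "n \<noteq> 4" using \<open>odd n\<close> by auto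
  moreover have "n \<noteq> 7" using no_critical_clique_7[OF G(1,2)] G(3) by blast
  ultimately show ?R by simp
next
  assume R: ?R
  define k where "k = n div 4"
  have "n mod 4 = 1 \<or> n mod 4 = 3" using \<open>odd n\<close> by presburger
  then have n: "n = 4 * k + 1 \<or> n = 4 * k + 3" unfolding k_def by presburger
  \<comment> \<open>For \<open>k \<le> 2\<close> the odd orders are 1, 3, 5, 7, 9 and 11, of which
    the hypothesis removes 1, 3 and 7.\<close>
  consider "n = 5" | "n = 9" | "n = 11" | "k \<ge> 3" "n = 4 * k + 1" | "k \<ge> 3" "n = 4 * k + 3"
    using n R by force
  then show ?L
  proof cases
    case 1
    show ?thesis unfolding \<open>n = 5\<close>
      by (rule deeply_critical_oriented_clique_nat[OF critical_clique_5]) simp_all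
  next
    case 2
    show ?thesis unfolding \<open>n = 9\<close>
      by (rule deeply_critical_oriented_clique_nat[OF critical_clique_9]) simp_all
  next
    case 3
    show ?thesis unfolding \<open>n = 11\<close>
      by (rule deeply_critical_oriented_clique_nat[OF critical_clique_11]) simp_all
  next
    case 4
    interpret proper_tournament "{..<k}" "\<lambda>i j. i < j \<and> (i, j) \<noteq> (0, k - 1) \<or> (j, i) = (0, k - 1)"
      using proper_tournament_cyclic[OF 4(1)] .
    show ?thesis
      by (rule deeply_critical_oriented_clique_nat[OF critical_clique_4k1]) (use 4 in \<open>simp_all add: card_layers\<close>)
  next
    case 5
    interpret proper_tournament "{..<k}" "\<lambda>i j. i < j \<and> (i, j) \<noteq> (0, k - 1) \<or> (j, i) = (0, k - 1)"
      using proper_tournament_cyclic[OF 5(1)] .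
    show ?thesis
      by (rule deeply_critical_oriented_clique_nat[OF critical_clique_4k3]) (use 5 in \<open>simp_all add: card_layers\<close>)
  qed
qed

end
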